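(* A nonnegative matrix $M$ with $\operatorname{rank}(M)\ge 2$ is a slack matrix of a polyhedral cone if and only if $M_{\mathrm{inc}}$ is an incidence matrix of some $\operatorname{rank}(M)$-dimensional pointed polyhedral cone.
   Context: A matrix $S\in\mathbb{R}^{p\times q}$ is a slack matrix of a polyhedral cone $K\subseteq\mathbb{R}^n$ if there are $A\in\mathbb{R}^{p\times n}$, $B\in\mathbb{R}^{n\times q}$ with $K=\{x\in\mathbb{R}^n: x^TB\ge 0\}=\{y^TA: y\in\mathbb{R}_+^p\}$ and $S=AB$. For a matrix $M$, $M_{\mathrm{inc}}$ is the $0/1$-matrix with $(M_{\mathrm{inc}})_{ij}=1$ iff $M_{ij}=0$. An incidence matrix of a polyhedral cone $K$ is a matrix $S_{\mathrm{inc}}$ for some slack matrix $S$ of $K$. A cone is pointed if its lineality space is $\{0\}$; its dimension is the dimension of its linear span. *)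

theory Defs
  imports "Jordan_Normal_Form.DL_Rank"
begin

definition slack_matrix_of :: "nat \<Rightarrow> real vec set \<Rightarrow> real mat \<Rightarrow> bool" where
  "slack_matrix_of n K S \<longleftrightarrow>
     (\<exists>A B. A \<in> carrier_mat (dim_row S) n \<and> B \<in> carrier_mat n (dim_col S) \<and>
        K = {x \<in> carrier_vec n. \<forall>j < dim_col S. x \<bullet> col B j \<ge> 0} \<and>
        K = {transpose_mat A *\<^sub>v y | y. y \<in> carrier_vec (dim_row S) \<and> (\<forall>i < dim_row S. y $ i \<ge> 0)} \<and>
        S = A * B)"

definition is_slack_matrix :: "real mat \<Rightarrow> bool" where
  "is_slack_matrix S \<longleftrightarrow> (\<exists>n K. slack_matrix_of n K S)"

definition inc_mat :: "real mat \<Rightarrow> real mat" where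
  "inc_mat M = mat (dim_row M) (dim_col M) (\<lambda>(i,j). if M $$ (i,j) = 0 then 1 else 0)"

definition incidence_matrix_of :: "nat \<Rightarrow> real vec set \<Rightarrow> real mat \<Rightarrow> bool" where
  "incidence_matrix_of n K N \<longleftrightarrow> (\<exists>S. slack_matrix_of n K S \<and> N = inc_mat S)"

definition polyhedral_cone :: "nat \<Rightarrow> real vec set \<Rightarrow> bool" where
  "polyhedral_cone n K \<longleftrightarrow> (\<exists>q B. B \<in> carrier_mat n q \<and>
      K = {x \<in> carrier_vec n. \<forall>j < q. x \<bullet> col B j \<ge> 0})"

definition pointed_cone :: "nat \<Rightarrow> real vec set \<Rightarrow> bool" where
  "pointed_cone n K \<longleftrightarrow> {x \<in> K. - x \<in> K} = {0\<^sub>v n}"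

definition (in vec_space) cone_dim :: "'a vec set \<Rightarrow> nat" where
  "cone_dim K = vectorspace.dim class_ring (span_vs K)"

end

theory Submission
  imports Defs "HOL-Library.Function_Algebras" "Jordan_Normal_Form.Matrix_Kernel"
begin

text \<open>
  A nonnegative matrix is a slack matrix iff its rows generate the cone of all nonnegative vectors
  in its row space. For such an \<open>M\<close>, a factorization \<open>M = C T\<close> through a basis \<open>T\<close> of the row space
  exhibits \<open>M\<close> as a slack matrix of the pointed cone \<open>{x. x\<^sup>T T \<ge> 0}\<close> of dimension \<open>rank M\<close>.

  Conversely, let \<open>S\<close> be a slack matrix of a pointed cone of dimension \<open>rank M\<close> with the zero
  pattern of \<open>M\<close>. Along a maximal chain of faces of the cone the rank of the rows of \<open>S\<close> on the
  faces grows by one in each step, while for \<open>M\<close> it grows by at least one; as the total ranks agree,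
  the rows on each face have the same rank in \<open>S\<close> and in \<open>M\<close>. Hence a vector in the \<open>M\<close>-span of a
  face that vanishes in the column of a facet lies in the \<open>M\<close>-span of this facet. Now subtract from
  a nonnegative vector in the row space of \<open>M\<close> the largest multiple of a row that keeps all facet
  columns nonnegative: this leads into the span of a facet \<open>G\<close>. Every facet of \<open>G\<close> also lies on a
  second facet of the cone, so the new vector is nonnegative in the facet columns of \<open>G\<close> as well, and
  induction over the faces applies.
\<close>

section \<open>Linear algebra\<close>

context vector_space
begin

lemma dim_insert_notin_span:
  assumes "finite G" and "a \<notin> span G"
  shows "dim (insert a G) = dim G + 1"
proof -
  obtain B where B: "B \<subseteq> G" "independent B" "G \<subseteq> span B" "card B = dim G"
    using basis_exists[of G] by blast
  have span_B: "span B = span G"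
    using span_mono[OF B(1)] span_minimal[OF B(3) subspace_span] by blast
  have "independent (insert a B)" and "a \<notin> B"
    using B(2) assms(2) span_B by (auto simp: independent_insert span_base)
  moreover have "span (insert a B) = span (insert a G)"
    using span_B by (simp add: span_insert)
  moreover have "finite B"
    using B(1) assms(1) finite_subset by blast
  ultimately show ?thesis
    using B(4) by (metis Suc_eq_plus1 card_insert_disjoint dim_eq_card)
qed

lemma dim_mono_finite:
  assumes "V \<subseteq> span W" and "finite W"
  shows "dim V \<le> dim W"
proof -
  obtain B where B: "B \<subseteq> W" "independent B" "W \<subseteq> span B" "card B = dim W"
    using basis_exists[of W] by blast
  have "V \<subseteq> span B"
    using assms(1) span_minimal[OF B(3) subspace_span] by blast
  then show ?thesis
    using dim_le_card[of V B] B(4) finite_subset[OF B(1) assms(2)] by simp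
qed

lemma span_eq_of_dim_le:
  assumes "finite F" and "finite G" and "G \<subseteq> span F" and "dim F \<le> dim G"
  shows "span G = span F"
proof
  show "span G \<subseteq> span F"
    using assms(3) by (simp add: span_minimal)
  have "F \<subseteq> span G"
  proof (rule ccontr)
    assume "\<not> F \<subseteq> span G"
    then obtain a where a: "a \<in> F" "a \<notin> span G" by blast
    have "insert a G \<subseteq> span F"
      using a(1) assms(3) by (simp add: span_base)
    then have "dim (insert a G) \<le> dim F"
      using assms(1) by (rule dim_mono_finite)
    then show False
      using dim_insert_notin_span[OF assms(2) a(2)] assms(4) by simp
  qed
  then show "span F \<subseteq> span G"
    by (simp add: span_minimal)
qed

lemma span_image_finite:
  assumes "finite F"
  shows "span (r ` F) = range (\<lambda>u. \<Sum>i\<in>F. u i *s r i)"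
proof (intro equalityI subsetI)
  fix x assume "x \<in> span (r ` F)"
  obtain U where U: "U \<subseteq> F" "inj_on r U" "r ` F = r ` U"
    using subset_image_inj[of "r ` F" r F] by auto
  have "finite U" using U(1) assms finite_subset by blast
  then obtain u where "x = (\<Sum>v\<in>r ` U. u v *s v)"
    using \<open>x \<in> span (r ` F)\<close> span_finite[of "r ` U"] unfolding U(3) by auto
  also have "\<dots> = (\<Sum>i\<in>U. u (r i) *s r i)"
    using U(2) by (simp add: sum.reindex)
  also have "\<dots> = (\<Sum>i\<in>F. (if i \<in> U then u (r i) else 0) *s r i)"
    using U(1) assms by (intro sum.mono_neutral_cong_left) auto
  finally show "x \<in> range (\<lambda>u. \<Sum>i\<in>F. u i *s r i)" 
    by (rule range_eqI[of _ _ "\<lambda>i. if i \<in> U then u (r i) else 0"])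
next
  fix x assume "x \<in> range (\<lambda>u. \<Sum>i\<in>F. u i *s r i)"
  then show "x \<in> span (r ` F)"
    by (auto intro!: span_sum span_scale intro: span_base)
qed

lemma independent_imageD:
  assumes inj: "inj_on r F" and "independent (r ` F)" and "finite F"
    and "(\<Sum>i\<in>F. u i *s r i) = 0" and "i \<in> F"
  shows "u i = 0"
proof -
  have "(\<Sum>v\<in>r ` F. u (the_inv_into F r v) *s v) = 0"
    using assms(4) inj by (simp add: sum.reindex the_inv_into_f_f)
  then have "u (the_inv_into F r (r i)) = 0"
    using assms(2,3,5) by (intro independentD[of "r ` F" "r ` F" "\<lambda>v. u (the_inv_into F r v)"]) auto
  then show ?thesis
    using inj assms(5) by (simp add: the_inv_into_f_f)
qed

end

lemma (in vector_space_pair) dim_image_eq_inj_on: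
  assumes f: "Vector_Spaces.linear s1 s2 f" and inj: "inj_on f (vs1.span S)"
  shows "vs2.dim (f ` S) = vs1.dim S"
proof -
  obtain B where B: "B \<subseteq> S" "vs1.independent B" "S \<subseteq> vs1.span B" "card B = vs1.dim S"
    using vs1.basis_exists[of S] by blast
  have "inj_on f (vs1.span B)"
    using inj inj_on_subset vs1.span_mono[OF B(1)] by blast
  then have "vs2.independent (f ` B)"
    using linear_independent_injective_image[OF f B(2)] by blast
  moreover have "f ` S \<subseteq> vs2.span (f ` B)"
    using B(3) linear_span_image[OF f, of B] by blast
  ultimately have "card (f ` B) = vs2.dim (f ` S)"
    using B(1) by (intro vs2.basis_card_eq_dim) auto
  moreover have "card (f ` B) = card B"
    using inj_on_subset[OF inj] B(1) vs1.span_superset by (intro card_image) blast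
  ultimately show ?thesis using B(4) by simp
qed

interpretation fun_vs: vector_space "\<lambda>(c::'a::field) (f::'j \<Rightarrow> 'a) j. c * f j"
  by unfold_locales (auto simp: fun_eq_iff algebra_simps)

interpretation fun_vs: vector_space_pair
    "\<lambda>(c::'a::field) (f::'j \<Rightarrow> 'a) j. c * f j" "\<lambda>(c::'a) (f::'k \<Rightarrow> 'a) j. c * f j" ..

abbreviation (input) fun_scale :: "'a::times \<Rightarrow> ('j \<Rightarrow> 'a) \<Rightarrow> 'j \<Rightarrow> 'a" (infixr "*\<^sub>f" 75) where
  "c *\<^sub>f f \<equiv> \<lambda>j. c * f j"

lemma sum_fun_apply [simp]: "(\<Sum>i\<in>I. f i) j = (\<Sum>i\<in>I. f i j)"
  by (induction I rule: infinite_finite_induct) auto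

lemma fun_span_vanish:
  assumes "x \<in> fun_vs.span X" and "\<And>f. f \<in> X \<Longrightarrow> f j = 0"
  shows "x j = 0"
  using assms(1)
  by (rule fun_vs.span_induct) (auto intro!: fun_vs.subspaceI simp: assms(2))

lemma linear_row_combination:
  fixes R :: "'i \<Rightarrow> 'j \<Rightarrow> 'a::field"
  shows "Vector_Spaces.linear (*\<^sub>f) (*\<^sub>f) (\<lambda>x. \<Sum>k\<in>F. x k *\<^sub>f R k)"
  unfolding Vector_Spaces.linear_iff
proof (intro conjI allI fun_vs.vector_space_axioms)
  fix c :: 'a and x y :: "'i \<Rightarrow> 'a"
  show "(\<Sum>k\<in>F. (x + y) k *\<^sub>f R k) = (\<Sum>k\<in>F. x k *\<^sub>f R k) + (\<Sum>k\<in>F. y k *\<^sub>f R k)"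
    by (simp add: fun_eq_iff sum.distrib distrib_right)
  show "(\<Sum>k\<in>F. (c *\<^sub>f x) k *\<^sub>f R k) = c *\<^sub>f (\<Sum>k\<in>F. x k *\<^sub>f R k)"
    by (rule ext) (simp only: sum_fun_apply sum_distrib_left mult.assoc)
qed

lemma span_diff_scaled_row:
  "x \<in> fun_vs.span (R ` F) \<Longrightarrow> a \<in> F \<Longrightarrow> x - c *\<^sub>f R a \<in> fun_vs.span (R ` F)"
  by (intro fun_vs.span_diff fun_vs.span_scale) (auto intro: fun_vs.span_base)

section \<open>Row cones\<close>

definition row_cone :: "('i \<Rightarrow> 'j \<Rightarrow> 'a::linordered_field) \<Rightarrow> 'i set \<Rightarrow> ('j \<Rightarrow> 'a) set" where
  "row_cone R F = {\<Sum>i\<in>F. y i *\<^sub>f R i | y. \<forall>i\<in>F. 0 \<le> y i}"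

lemma zero_in_row_cone: "0 \<in> row_cone R F"
  unfolding row_cone_def by (rule CollectI, rule exI[of _ 0]) (simp add: fun_eq_iff)

lemma row_cone_subset_span: "row_cone R F \<subseteq> fun_vs.span (R ` F)"
  unfolding row_cone_def by (auto intro!: fun_vs.span_sum fun_vs.span_scale intro: fun_vs.span_base)

lemma row_cone_mono:
  assumes "finite F" and "G \<subseteq> F"
  shows "row_cone R G \<subseteq> row_cone R F"
proof
  fix x assume "x \<in> row_cone R G"
  then obtain y where y: "\<forall>i\<in>G. 0 \<le> y i" "x = (\<Sum>i\<in>G. y i *\<^sub>f R i)"
    unfolding row_cone_def by blast
  have "x = (\<Sum>i\<in>F. (if i \<in> G then y i else 0) *\<^sub>f R i)"
    unfolding y(2) using assms by (intro sum.mono_neutral_cong_left) (auto simp: fun_eq_iff)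
  then show "x \<in> row_cone R F"
    unfolding row_cone_def using y(1) by (intro CollectI exI conjI) auto
qed

lemma row_cone_add_scaled_row:
  assumes "finite F" and "a \<in> F" and "x \<in> row_cone R F" and "0 \<le> t"
  shows "x + t *\<^sub>f R a \<in> row_cone R F"
proof -
  obtain y where y: "\<forall>i\<in>F. 0 \<le> y i" "x = (\<Sum>i\<in>F. y i *\<^sub>f R i)"
    using assms(3) unfolding row_cone_def by blast
  have "x + t *\<^sub>f R a = (\<Sum>i\<in>F. (y(a := y a + t)) i *\<^sub>f R i)"
    unfolding y(2) using assms(1,2)
    by (simp add: fun_eq_iff sum.remove[OF assms(1,2)] algebra_simps)
  moreover have "\<forall>i\<in>F. 0 \<le> (y(a := y a + t)) i"
    using y(1) assms(2,4) by simp
  ultimately show ?thesis unfolding row_cone_def by blast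
qed

definition row_cone_generating :: "'i set \<Rightarrow> 'j set \<Rightarrow> ('i \<Rightarrow> 'j \<Rightarrow> 'a::linordered_field) \<Rightarrow> bool" where
  "row_cone_generating P Q R \<longleftrightarrow>
    (\<forall>x \<in> fun_vs.span (R ` P). (\<forall>j\<in>Q. 0 \<le> x j) \<longrightarrow> x \<in> row_cone R P)"

lemma ratio_test:
  fixes x d :: "'j \<Rightarrow> 'a::linordered_field"
  assumes "finite J" and "J \<noteq> {}" and pos: "\<And>j. j \<in> J \<Longrightarrow> 0 < d j"
  obtains k t where "k \<in> J" and "x k = t * d k" and "\<forall>j\<in>J. t * d j \<le> x j"
proof -
  define t where "t = Min ((\<lambda>j. x j / d j) ` J)"
  have "t \<in> (\<lambda>j. x j / d j) ` J"
    unfolding t_def using assms(1,2) by (intro Min_in) auto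
  then obtain k where k: "k \<in> J" "t = x k / d k" by blast
  have "t \<le> x j / d j" if "j \<in> J" for j
    unfolding t_def using assms(1) that by (intro Min_le) auto
  then have "t * d j \<le> x j" if "j \<in> J" for j
    using that pos by (simp add: pos_le_divide_eq)
  moreover have "x k = t * d k"
    using k pos[OF k(1)] by simp
  ultimately show ?thesis using that k(1) by blast
qed

lemma nonneg_add_multiple:
  fixes w z :: "'j \<Rightarrow> 'a::linordered_field"
  assumes "finite Q" and nonneg: "\<And>j. j \<in> Q \<Longrightarrow> 0 \<le> z j"
    and zero: "\<And>j. j \<in> Q \<Longrightarrow> z j = 0 \<Longrightarrow> 0 \<le> w j"
  obtains N where "\<And>j. j \<in> Q \<Longrightarrow> 0 \<le> w j + N * z j"
proof
  fix j assume j: "j \<in> Q"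
  let ?N = "\<Sum>j\<in>Q. \<bar>w j\<bar> / z j"
  show "0 \<le> w j + ?N * z j"
  proof (cases "z j = 0")
    case False
    then have "0 < z j" using nonneg[OF j] by simp
    moreover have "\<bar>w j\<bar> / z j \<le> ?N"
      using nonneg by (intro member_le_sum[OF j] assms(1)) auto
    ultimately have "\<bar>w j\<bar> \<le> ?N * z j" by (simp add: field_simps)
    then show ?thesis by linarith
  qed (simp add: zero[OF j])
qed

section \<open>Faces of a zero pattern\<close>

locale incidence =
  fixes P :: "'i set" and Q :: "'j set" and Z :: "'j \<Rightarrow> 'i set"
  assumes finite_P: "finite P" and finite_Q: "finite Q"
begin

text \<open>A face of the cone generated by the rows is encoded by the set of rows lying on it, \<open>Z j\<close>
  being the set of rows that vanish in column \<open>j\<close>; \<open>facet F j\<close> says that column \<open>j\<close> cuts a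
  maximal proper face \<open>F \<inter> Z j\<close> out of \<open>F\<close>.\<close>

definition face :: "'i set \<Rightarrow> bool" where
  "face F \<longleftrightarrow> F \<subseteq> P \<and> (\<forall>i\<in>P. (\<forall>j\<in>Q. F \<subseteq> Z j \<longrightarrow> i \<in> Z j) \<longrightarrow> i \<in> F)"

definition facet :: "'i set \<Rightarrow> 'j \<Rightarrow> bool" where
  "facet F j \<longleftrightarrow> j \<in> Q \<and> \<not> F \<subseteq> Z j \<and>
     (\<forall>k\<in>Q. F \<inter> Z j \<subseteq> Z k \<longrightarrow> \<not> F \<subseteq> Z k \<longrightarrow> F \<inter> Z k \<subseteq> Z j)"

definition diamond :: bool where
  "diamond \<longleftrightarrow> (\<forall>F j j'. face F \<longrightarrow> facet F j \<longrightarrow> facet (F \<inter> Z j) j' \<longrightarrow>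
     (\<exists>k. facet F k \<and> F \<inter> Z j \<inter> Z k = F \<inter> Z j \<inter> Z j'))"

definition graded :: "('i \<Rightarrow> 'j \<Rightarrow> 'a::field) \<Rightarrow> bool" where
  "graded R \<longleftrightarrow> (\<forall>F j. face F \<longrightarrow> facet F j \<longrightarrow>
     fun_vs.dim (R ` F) = fun_vs.dim (R ` (F \<inter> Z j)) + 1)"

lemma gradedD:
  "graded R \<Longrightarrow> face F \<Longrightarrow> facet F j \<Longrightarrow> fun_vs.dim (R ` F) = fun_vs.dim (R ` (F \<inter> Z j)) + 1"
  unfolding graded_def by blast

lemma face_P: "face P"
  by (auto simp: face_def)

lemma face_subset: "face F \<Longrightarrow> F \<subseteq> P"
  by (simp add: face_def)

lemma face_finite: "face F \<Longrightarrow> finite F"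
  using face_subset finite_P finite_subset by blast

lemma face_Int: "face F \<Longrightarrow> j \<in> Q \<Longrightarrow> face (F \<inter> Z j)"
  unfolding face_def by blast

lemma facet_in_Q: "facet F j \<Longrightarrow> j \<in> Q"
  by (simp add: facet_def)

lemma face_Int_facet: "face F \<Longrightarrow> facet F j \<Longrightarrow> face (F \<inter> Z j)"
  by (rule face_Int[OF _ facet_in_Q])

lemma facet_psubset: "facet F j \<Longrightarrow> F \<inter> Z j \<subset> F"
  by (auto simp: facet_def)

lemma facet_exists:
  assumes "k \<in> Q" and "\<not> F \<subseteq> Z k"
  obtains j where "facet F j"
proof -
  let ?A = "(\<lambda>j. F \<inter> Z j) ` {j \<in> Q. \<not> F \<subseteq> Z j}"
  have "finite ?A" and "F \<inter> Z k \<in> ?A"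
    using assms finite_Q by auto
  then obtain G where G: "G \<in> ?A" "\<forall>B\<in>?A. G \<subseteq> B \<longrightarrow> G = B"
    by (rule finite_has_maximal2[elim_format]) blast
  then obtain j where j: "j \<in> Q" "\<not> F \<subseteq> Z j" "G = F \<inter> Z j" by blast
  have "facet F j"
    unfolding facet_def
  proof (intro conjI ballI impI)
    fix l assume "l \<in> Q" "F \<inter> Z j \<subseteq> Z l" "\<not> F \<subseteq> Z l"
    then have "F \<inter> Z l \<in> ?A" "G \<subseteq> F \<inter> Z l"
      using j(3) by auto
    then have "G = F \<inter> Z l"
      using G(2) by blast
    then show "F \<inter> Z l \<subseteq> Z j"
      using j(3) by blast
  qed (use j in auto)
  then show ?thesis using that by blast
qed

lemma face_psubset_separated:
  assumes "face G" and "face F" and "G \<subset> F"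
  obtains j a where "j \<in> Q" "G \<subseteq> Z j" "a \<in> F" "a \<notin> Z j"
  using assms unfolding face_def by blast

lemma face_is_facet_of_face:
  assumes F: "face F" and "F \<noteq> P"
  obtains F' j where "face F'" "facet F' j" "F' \<inter> Z j = F"
proof -
  let ?A = "{F'. face F' \<and> F \<subset> F'}"
  have "finite ?A"
    using finite_P face_subset by (intro finite_subset[of ?A "Pow P"]) auto
  moreover have "P \<in> ?A"
    using assms face_P face_subset[OF F] by auto
  ultimately obtain F' where F': "F' \<in> ?A" and minimal: "\<forall>B\<in>?A. B \<subseteq> F' \<longrightarrow> F' = B"
    by (rule finite_has_minimal2[elim_format]) blast
  obtain j a where j: "j \<in> Q" "F \<subseteq> Z j" "a \<in> F'" "a \<notin> Z j"
    using face_psubset_separated[OF F] F' by blast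
  have meet: "F' \<inter> Z k = F" if k: "k \<in> Q" "F \<subseteq> Z k" "\<not> F' \<subseteq> Z k" for k
  proof (rule ccontr)
    assume "F' \<inter> Z k \<noteq> F"
    then have "F' \<inter> Z k \<in> ?A"
      using F' k(1,2) face_Int by auto
    then have "F' = F' \<inter> Z k"
      using minimal by blast
    then show False using k(3) by blast
  qed
  have "F' \<inter> Z j = F" using meet j by blast
  moreover from this have "facet F' j"
    unfolding facet_def using j meet by auto
  ultimately show ?thesis using that F' by blast
qed

end

section \<open>Nonnegative matrices with a given zero pattern\<close>

locale realization = incidence P Q Z
  for P :: "'i set" and Q :: "'j set" and Z :: "'j \<Rightarrow> 'i set" +
  fixes R :: "'i \<Rightarrow> 'j \<Rightarrow> 'a::linordered_field"
  assumes outside: "i \<in> P \<Longrightarrow> j \<notin> Q \<Longrightarrow> R i j = 0"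
    and nonneg: "i \<in> P \<Longrightarrow> j \<in> Q \<Longrightarrow> 0 \<le> R i j"
    and zero_iff: "i \<in> P \<Longrightarrow> j \<in> Q \<Longrightarrow> R i j = 0 \<longleftrightarrow> i \<in> Z j"
begin

lemma pos: "i \<in> P \<Longrightarrow> j \<in> Q \<Longrightarrow> i \<notin> Z j \<Longrightarrow> 0 < R i j"
  using nonneg zero_iff by (metis order_le_less)

lemma span_vanish:
  assumes "x \<in> fun_vs.span (R ` F)" and "F \<subseteq> P" and "j \<in> Q" and "F \<subseteq> Z j"
  shows "x j = 0"
  using assms(1) by (rule fun_span_vanish) (use assms(2-4) zero_iff in blast)

lemma row_notin_span:
  assumes "a \<in> P" and "a \<notin> Z j" and "F \<subseteq> P" and "j \<in> Q" and "F \<subseteq> Z j"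
  shows "R a \<notin> fun_vs.span (R ` F)"
  using span_vanish[OF _ assms(3-5)] zero_iff[OF assms(1,4)] assms(2) by blast

lemma span_face_in_all_zeros:
  assumes "F \<subseteq> P" and "\<And>k. k \<in> Q \<Longrightarrow> F \<subseteq> Z k"
  shows "fun_vs.span (R ` F) = {0}"
proof -
  have "R i j = 0" if "i \<in> F" for i j
    using that assms zero_iff outside by blast
  then have "R ` F \<subseteq> {0}" by (auto simp: fun_eq_iff)
  then show ?thesis
    using fun_vs.span_mono[of "R ` F" "{0}"] fun_vs.span_zero by auto
qed

lemma dim_face_less:
  assumes "face G" and "face F" and "G \<subset> F"
  shows "fun_vs.dim (R ` G) < fun_vs.dim (R ` F)"
proof -
  obtain j a where j: "j \<in> Q" "G \<subseteq> Z j" and a: "a \<in> F" "a \<notin> Z j"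
    using face_psubset_separated[OF assms] .
  have "R a \<notin> fun_vs.span (R ` G)"
    using row_notin_span[OF _ a(2) face_subset[OF assms(1)] j] face_subset[OF assms(2)] a(1)
    by blast
  then have "fun_vs.dim (insert (R a) (R ` G)) = fun_vs.dim (R ` G) + 1"
    using fun_vs.dim_insert_notin_span face_finite[OF assms(1)] by blast
  moreover have "insert (R a) (R ` G) \<subseteq> fun_vs.span (R ` F)"
    using a(1) assms(3) by (auto intro: fun_vs.span_base)
  then have "fun_vs.dim (insert (R a) (R ` G)) \<le> fun_vs.dim (R ` F)"
    using face_finite[OF assms(2)] by (intro fun_vs.dim_mono_finite) auto
  ultimately show ?thesis by simp
qed

lemma facet_of_dim:
  assumes F: "face F" and k: "k \<in> Q" "\<not> F \<subseteq> Z k"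
    and dim: "fun_vs.dim (R ` F) \<le> fun_vs.dim (R ` (F \<inter> Z k)) + 1"
  shows "facet F k"
  unfolding facet_def
proof (intro conjI ballI impI)
  fix l assume l: "l \<in> Q" "F \<inter> Z k \<subseteq> Z l" "\<not> F \<subseteq> Z l"
  show "F \<inter> Z l \<subseteq> Z k"
  proof (rule ccontr)
    assume "\<not> F \<inter> Z l \<subseteq> Z k"
    then have "fun_vs.dim (R ` (F \<inter> Z k)) < fun_vs.dim (R ` (F \<inter> Z l))"
      using l(2) by (intro dim_face_less face_Int F k(1) l(1)) auto
    moreover have "fun_vs.dim (R ` (F \<inter> Z l)) < fun_vs.dim (R ` F)"
      using l(3) by (intro dim_face_less face_Int F l(1)) auto
    ultimately show False using dim by linarith
  qed
qed (use k in auto)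

lemma dim_eq_of_kernel_in_span:
  assumes F: "face F" and j: "j \<in> Q" and a: "a \<in> F" "a \<notin> Z j"
    and kernel: "\<And>x. x \<in> fun_vs.span (R ` F) \<Longrightarrow> x j = 0 \<Longrightarrow> x \<in> fun_vs.span (R ` (F \<inter> Z j))"
  shows "fun_vs.dim (R ` F) = fun_vs.dim (R ` (F \<inter> Z j)) + 1"
proof -
  let ?G = "F \<inter> Z j"
  have "R a j \<noteq> 0" and notin: "R a \<notin> fun_vs.span (R ` ?G)"
    using zero_iff[OF _ j] row_notin_span[OF _ a(2) _ j, of ?G] face_subset[OF F] a by auto
  have "x \<in> fun_vs.span (insert (R a) (R ` ?G))" if "x \<in> fun_vs.span (R ` F)" for x
  proof -
    have "x - (x j / R a j) *\<^sub>f R a \<in> fun_vs.span (R ` F)"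
      using that a(1) by (rule span_diff_scaled_row)
    then have "x - (x j / R a j) *\<^sub>f R a \<in> fun_vs.span (R ` ?G)"
      by (rule kernel) (simp add: \<open>R a j \<noteq> 0\<close>)
    then show ?thesis unfolding fun_vs.span_insert by blast
  qed
  then have "fun_vs.span (R ` F) \<subseteq> fun_vs.span (insert (R a) (R ` ?G))" by blast
  moreover have "fun_vs.span (insert (R a) (R ` ?G)) \<subseteq> fun_vs.span (R ` F)"
    using a(1) by (intro fun_vs.span_mono) blast
  ultimately have "fun_vs.dim (R ` F) = fun_vs.dim (insert (R a) (R ` ?G))"
    by (intro fun_vs.span_eq_dim order_antisym)
  also have "\<dots> = fun_vs.dim (R ` ?G) + 1"
    using face_finite[OF F] by (intro fun_vs.dim_insert_notin_span notin) simp
  finally show ?thesis .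
qed

lemma graded_kernel_in_span:
  assumes graded: "graded R" and F: "face F" and j: "facet F j"
    and x: "x \<in> fun_vs.span (R ` F)" "x j = 0"
  shows "x \<in> fun_vs.span (R ` (F \<inter> Z j))"
proof -
  let ?G = "F \<inter> Z j"
  obtain a where a: "a \<in> F" "a \<notin> Z j" and jQ: "j \<in> Q"
    using j unfolding facet_def by blast
  have G: "?G \<subseteq> P" "?G \<subseteq> Z j" and fin: "finite F" "finite ?G"
    using face_subset[OF F] face_finite[OF F] by auto
  have "R a \<notin> fun_vs.span (R ` ?G)"
    using row_notin_span[OF _ a(2) G(1) jQ G(2)] a(1) face_subset[OF F] by blast
  then have "fun_vs.dim (insert (R a) (R ` ?G)) = fun_vs.dim (R ` F)"
    using fun_vs.dim_insert_notin_span[of "R ` ?G" "R a"] fin gradedD[OF graded F j] by simp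
  then have "fun_vs.span (insert (R a) (R ` ?G)) = fun_vs.span (R ` F)"
    using a(1) fin by (intro fun_vs.span_eq_of_dim_le) (auto intro: fun_vs.span_base)
  then obtain c where c: "x - c *\<^sub>f R a \<in> fun_vs.span (R ` ?G)"
    using x(1) by (auto simp: fun_vs.span_insert)
  have "x j - c * R a j = 0"
    using span_vanish[OF c G(1) jQ G(2)] by simp
  then have "c = 0"
    using x(2) zero_iff[OF _ jQ] a face_subset[OF F] by auto
  then show ?thesis
    using c by (simp add: fun_diff_def)
qed

lemma row_cone_support:
  assumes "x \<in> row_cone R P"
  shows "x \<in> row_cone R {i \<in> P. \<forall>j\<in>Q. x j = 0 \<longrightarrow> i \<in> Z j}" (is "_ \<in> row_cone R ?F")
proof -
  obtain y where y: "\<forall>i\<in>P. 0 \<le> y i" "x = (\<Sum>i\<in>P. y i *\<^sub>f R i)"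
    using assms unfolding row_cone_def by blast
  have "y i *\<^sub>f R i = 0" if "i \<in> P - ?F" for i
  proof -
    obtain j where i: "i \<in> P" and j: "j \<in> Q" "x j = 0" "i \<notin> Z j" using \<open>i \<in> P - ?F\<close> by blast
    have "(\<Sum>i\<in>P. y i * R i j) = 0"
      using j(2) unfolding y(2) by simp
    then have "y i * R i j = 0"
      using i y(1) nonneg[OF _ j(1)] finite_P by (subst (asm) sum_nonneg_eq_0_iff) auto
    then have "y i = 0"
      using zero_iff[OF i j(1)] j(3) by simp
    then show ?thesis by (simp add: fun_eq_iff)
  qed
  then have "x = (\<Sum>i\<in>?F. y i *\<^sub>f R i)"
    unfolding y(2) by (intro sum.mono_neutral_right finite_P) blast+
  then show ?thesis
    unfolding row_cone_def using y(1) by blast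
qed

lemma face_row_cone:
  assumes F: "face F" and x: "x \<in> fun_vs.span (R ` F)" "x \<in> row_cone R P" and k: "k \<in> Q" "x k = 0"
  shows "x \<in> row_cone R (F \<inter> Z k)"
proof -
  let ?F = "{i \<in> P. \<forall>j\<in>Q. x j = 0 \<longrightarrow> i \<in> Z j}"
  have "x j = 0" if "j \<in> Q" "F \<subseteq> Z j" for j
    using span_vanish[OF x(1) face_subset[OF F] that] .
  then have "?F \<subseteq> F \<inter> Z k"
    using F k unfolding face_def by blast
  then show ?thesis
    using row_cone_support[OF x(2)] row_cone_mono[of "F \<inter> Z k" ?F R] face_finite[OF F] by auto
qed

lemma sum_rows_eq_0_iff:
  assumes "H \<subseteq> P" and "j \<in> Q"
  shows "(\<Sum>i\<in>H. R i j) = 0 \<longleftrightarrow> H \<subseteq> Z j"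
  using assms finite_subset[OF assms(1) finite_P] nonneg zero_iff
  by (subst sum_nonneg_eq_0_iff) blast+

text \<open>Adding a large multiple of the sum of the rows in \<open>H\<close>, a relative interior point of that
  face, makes \<open>w\<close> nonnegative in all columns.\<close>

lemma nonneg_at_face_in_span:
  assumes generating: "row_cone_generating P Q R" and F: "face F" and H: "H \<subseteq> F"
    and w: "w \<in> fun_vs.span (R ` F)" "\<And>j. j \<in> Q \<Longrightarrow> H \<subseteq> Z j \<Longrightarrow> 0 \<le> w j"
    and k: "k \<in> Q" "H \<subseteq> Z k" "w k = 0"
  shows "w \<in> fun_vs.span (R ` (F \<inter> Z k))"
proof -
  define z where "z = (\<Sum>i\<in>H. R i)"
  have F_P: "F \<subseteq> P" and H_P: "H \<subseteq> P"
    using face_subset[OF F] H by auto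
  have z_span: "z \<in> fun_vs.span (R ` G)" if "H \<subseteq> G" for G
    unfolding z_def using that by (intro fun_vs.span_sum fun_vs.span_base) auto
  have z_eq_0: "z j = 0 \<longleftrightarrow> H \<subseteq> Z j" if "j \<in> Q" for j
    unfolding z_def using sum_rows_eq_0_iff[OF H_P that] by simp
  have "0 \<le> z j" if "j \<in> Q" for j
    unfolding z_def using nonneg[OF _ that] H_P by (auto intro!: sum_nonneg)
  then obtain N where N: "\<And>j. j \<in> Q \<Longrightarrow> 0 \<le> w j + N * z j"
    using nonneg_add_multiple[OF finite_Q] w(2) z_eq_0 by metis
  let ?x = "w + N *\<^sub>f z"
  have x_span: "?x \<in> fun_vs.span (R ` F)"
    using w(1) z_span[OF H] by (intro fun_vs.span_add fun_vs.span_scale)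
  moreover have "?x \<in> row_cone R P"
    using generating x_span fun_vs.span_mono[OF image_mono[OF F_P], of R] N
    unfolding row_cone_generating_def by auto
  moreover have "?x k = 0" using z_eq_0 k by simp
  ultimately have "?x \<in> row_cone R (F \<inter> Z k)"
    using face_row_cone[OF F] k(1) by blast
  then have "?x - N *\<^sub>f z \<in> fun_vs.span (R ` (F \<inter> Z k))"
    using H k(2) subsetD[OF row_cone_subset_span]
    by (intro fun_vs.span_diff fun_vs.span_scale z_span) auto
  then show ?thesis by simp
qed

lemma subtract_row_to_tight_column:
  assumes generating: "row_cone_generating P Q R" and F: "face F" and H: "H \<subseteq> F" and a: "a \<in> F"
    and v: "v \<in> fun_vs.span (R ` F)" "\<And>l. l \<in> Q \<Longrightarrow> H \<subseteq> Z l \<Longrightarrow> a \<in> Z l \<Longrightarrow> 0 \<le> v l"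
    and j: "j \<in> Q" "H \<subseteq> Z j" "a \<notin> Z j"
  obtains t k where "k \<in> Q" "H \<subseteq> Z k" "a \<notin> Z k" "v - t *\<^sub>f R a \<in> fun_vs.span (R ` (F \<inter> Z k))"
proof -
  have a_P: "a \<in> P" using a face_subset[OF F] by blast
  define J where "J = {k \<in> Q. H \<subseteq> Z k \<and> a \<notin> Z k}"
  have "finite J" "J \<noteq> {}" "\<And>k. k \<in> J \<Longrightarrow> 0 < R a k"
    using finite_Q j pos[OF a_P] unfolding J_def by auto
  then obtain k t where k: "k \<in> J" "v k = t * R a k" and t: "\<forall>l\<in>J. t * R a l \<le> v l"
    by (rule ratio_test[of J "R a" v])
  have "v - t *\<^sub>f R a \<in> fun_vs.span (R ` (F \<inter> Z k))"
  proof (rule nonneg_at_face_in_span[OF generating F H])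
    show "v - t *\<^sub>f R a \<in> fun_vs.span (R ` F)"
      using v(1) a by (rule span_diff_scaled_row)
    show "0 \<le> (v - t *\<^sub>f R a) l" if l: "l \<in> Q" "H \<subseteq> Z l" for l
      using l t v(2)[OF l] zero_iff[OF a_P l(1)] by (cases "a \<in> Z l") (auto simp: J_def)
  qed (use k in \<open>auto simp: J_def\<close>)
  then show ?thesis
    using that k(1) by (auto simp: J_def)
qed

text \<open>Moving along a row off the facet until a column vanishing on the facet becomes tight leads
  into the span of the facet, so a vector vanishing in the facet column has not been moved.\<close>

lemma graded_if_generating:
  assumes generating: "row_cone_generating P Q R"
  shows "graded R"
  unfolding graded_def
proof (intro allI impI)
  fix F j assume F: "face F" and j: "facet F j"
  obtain a where a: "a \<in> F" "a \<notin> Z j" and jQ: "j \<in> Q"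
    using j unfolding facet_def by blast
  have F_P: "F \<subseteq> P" using face_subset[OF F] .
  show "fun_vs.dim (R ` F) = fun_vs.dim (R ` (F \<inter> Z j)) + 1"
  proof (rule dim_eq_of_kernel_in_span[OF F jQ a])
    fix x assume x: "x \<in> fun_vs.span (R ` F)" "x j = 0"
    have "0 \<le> x l" if l: "l \<in> Q" "F \<inter> Z j \<subseteq> Z l" "a \<in> Z l" for l
    proof -
      have "F \<subseteq> Z l" using j l a unfolding facet_def by blast
      then show ?thesis using span_vanish[OF x(1) F_P l(1)] by simp
    qed
    then obtain t k where k: "k \<in> Q" "F \<inter> Z j \<subseteq> Z k" "a \<notin> Z k"
      and w: "x - t *\<^sub>f R a \<in> fun_vs.span (R ` (F \<inter> Z k))"
      using subtract_row_to_tight_column[OF generating F _ a(1) x(1) _ jQ _ a(2), of "F \<inter> Z j"]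
      by blast
    have "F \<inter> Z k \<subseteq> F \<inter> Z j" using j k a(1) unfolding facet_def by blast
    then have w': "x - t *\<^sub>f R a \<in> fun_vs.span (R ` (F \<inter> Z j))"
      using w fun_vs.span_mono[OF image_mono] by blast
    have "(x - t *\<^sub>f R a) j = 0"
      using F_P by (intro span_vanish[OF w' _ jQ]) auto
    then have "t = 0"
      using x(2) zero_iff[OF _ jQ] a F_P by auto
    then show "x \<in> fun_vs.span (R ` (F \<inter> Z j))"
      using w' by (simp add: fun_diff_def)
  qed
qed

text \<open>Moving from a row off the facet \<open>G = F \<inter> Z j\<close> against a row of \<open>G\<close> off its facet \<open>G \<inter> Z j'\<close>
  leads to a second facet of \<open>F\<close> through \<open>G \<inter> Z j'\<close>.\<close>

lemma diamond_if_generating: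
  assumes generating: "row_cone_generating P Q R"
  shows diamond
  unfolding diamond_def
proof (intro allI impI)
  fix F j j' assume F: "face F" and j: "facet F j" and j': "facet (F \<inter> Z j) j'"
  define G where "G = F \<inter> Z j"
  define H where "H = G \<inter> Z j'"
  have Q: "j \<in> Q" "j' \<in> Q" using j j' facet_in_Q by auto
  have G: "face G" and H: "face H" "H \<subseteq> F" "H \<subseteq> Z j'"
    using face_Int F Q by (auto simp: G_def H_def)
  obtain a where a: "a \<in> F" "a \<notin> Z j"
    using j unfolding facet_def by blast
  obtain h where h: "h \<in> F" "h \<in> Z j" "h \<notin> Z j'"
    using j' unfolding facet_def by blast
  have P: "F \<subseteq> P" "a \<in> P" "h \<in> P" using face_subset[OF F] a(1) h(1) by auto
  have "R a \<in> fun_vs.span (R ` F)" using a(1) by (simp add: fun_vs.span_base)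
  moreover have "0 \<le> R a l" if "l \<in> Q" for l
    using nonneg[OF P(2) that] .
  ultimately obtain t k where k: "k \<in> Q" "H \<subseteq> Z k" "h \<notin> Z k"
    and w: "R a - t *\<^sub>f R h \<in> fun_vs.span (R ` (F \<inter> Z k))"
    by (rule subtract_row_to_tight_column[OF generating F H(2) h(1) _ _ Q(2) H(3) h(3)])
  have "(R a - t *\<^sub>f R h) j \<noteq> 0"
    using zero_iff[OF P(2) Q(1)] zero_iff[OF P(3) Q(1)] a(2) h(2) by simp
  then have "\<not> F \<inter> Z k \<subseteq> Z j"
    using span_vanish[OF w _ Q(1)] P(1) by blast
  then have "H \<subset> F \<inter> Z k"
    using H(2) k(2) by (auto simp: H_def G_def)
  then have "fun_vs.dim (R ` H) < fun_vs.dim (R ` (F \<inter> Z k))"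
    by (intro dim_face_less H face_Int F k)
  moreover have "graded R" using generating by (rule graded_if_generating)
  then have "fun_vs.dim (R ` F) = fun_vs.dim (R ` H) + 2"
    using gradedD[of R F j] gradedD[of R G j'] F G j j' by (simp add: G_def H_def)
  ultimately have "facet F k"
    using h(1) k by (intro facet_of_dim F) auto
  moreover have "G \<inter> Z k = H"
    using j' k h unfolding facet_def H_def G_def by blast
  ultimately show "\<exists>k. facet F k \<and> F \<inter> Z j \<inter> Z k = F \<inter> Z j \<inter> Z j'"
    unfolding G_def H_def by blast
qed

lemma graded_dim_le:
  assumes S: "graded (S :: 'i \<Rightarrow> 'j \<Rightarrow> 'b::linordered_field)" "realization P Q Z S"
  shows "face F \<Longrightarrow> fun_vs.dim (S ` F) \<le> fun_vs.dim (R ` F)"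
proof (induction "card F" arbitrary: F rule: less_induct)
  case less
  note F = \<open>face F\<close>
  interpret S: realization P Q Z S by fact
  show ?case
  proof (cases "\<exists>k\<in>Q. \<not> F \<subseteq> Z k")
    case False
    then have "fun_vs.span (S ` F) = {0}"
      by (intro S.span_face_in_all_zeros face_subset[OF F]) blast
    then have "S ` F \<subseteq> fun_vs.span {}"
      using fun_vs.span_superset[of "S ` F"] by simp
    then show ?thesis
      using fun_vs.dim_le_card[of "S ` F" "{}"] by simp
  next
    case True
    then obtain j where j: "facet F j" using facet_exists by blast
    have G: "face (F \<inter> Z j)" "F \<inter> Z j \<subset> F"
      using face_Int_facet[OF F j] facet_psubset[OF j] by auto
    have "fun_vs.dim (S ` (F \<inter> Z j)) \<le> fun_vs.dim (R ` (F \<inter> Z j))"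
      using less.hyps[OF psubset_card_mono[OF face_finite[OF F] G(2)] G(1)] .
    then show ?thesis
      using gradedD[OF S(1) F j] dim_face_less[OF G(1) F G(2)] by linarith
  qed
qed

lemma graded_dim_ge:
  assumes S: "graded (S :: 'i \<Rightarrow> 'j \<Rightarrow> 'b::field)"
    and dim: "fun_vs.dim (R ` P) \<le> fun_vs.dim (S ` P)"
  shows "face F \<Longrightarrow> fun_vs.dim (R ` F) \<le> fun_vs.dim (S ` F)"
proof (induction "card (P - F)" arbitrary: F rule: less_induct)
  case less
  note F = \<open>face F\<close>
  show ?case
  proof (cases "F = P")
    case True
    then show ?thesis using dim by simp
  next
    case False
    then obtain F' j where F': "face F'" and j: "facet F' j" and F_eq: "F' \<inter> Z j = F"
      using face_is_facet_of_face[OF F] by metis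
    have F_F': "F \<subset> F'" using facet_psubset[OF j] F_eq by simp
    then have "card (P - F') < card (P - F)"
      using finite_P face_subset[OF F'] by (intro psubset_card_mono) auto
    then have "fun_vs.dim (R ` F') \<le> fun_vs.dim (S ` F')"
      using less.hyps F' by blast
    then show ?thesis
      using gradedD[OF S F' j] dim_face_less[OF F F' F_F'] unfolding F_eq by linarith
  qed
qed

text \<open>Along a chain of faces the dimensions grow by exactly one in \<open>S\<close> and by at least one in \<open>R\<close>,
  so they agree everywhere once they agree at the top.\<close>

lemma graded_transfer:
  assumes S: "graded (S :: 'i \<Rightarrow> 'j \<Rightarrow> 'b::linordered_field)" "realization P Q Z S"
    and dim: "fun_vs.dim (R ` P) \<le> fun_vs.dim (S ` P)"
  shows "graded R"
proof -
  have "fun_vs.dim (R ` F) = fun_vs.dim (S ` F)" if "face F" for F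
    using graded_dim_le[OF S that] graded_dim_ge[OF S(1) dim that] by (rule order_antisym[rotated])
  then show ?thesis
    using gradedD[OF S(1)] face_Int_facet unfolding graded_def by simp
qed

text \<open>By the diamond property each facet column of a facet \<open>G\<close> of \<open>F\<close> is, on the span of \<open>G\<close>, a
  positive multiple of a facet column of \<open>F\<close>.\<close>

lemma nonneg_on_facets_of_facet:
  assumes "graded R" and diamond and F: "face F" and j: "facet F j"
    and y: "y \<in> fun_vs.span (R ` (F \<inter> Z j))" "\<And>l. facet F l \<Longrightarrow> 0 \<le> y l"
    and j': "facet (F \<inter> Z j) j'"
  shows "0 \<le> y j'"
proof -
  define G where "G = F \<inter> Z j"
  have G: "face G" using face_Int_facet[OF F j] by (simp add: G_def)
  obtain k where k: "facet F k" "G \<inter> Z k = G \<inter> Z j'"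
    using \<open>diamond\<close> F j j' unfolding diamond_def G_def by blast
  have Q: "j' \<in> Q" "k \<in> Q" using j' k(1) facet_in_Q by auto
  obtain h where h: "h \<in> G" "h \<notin> Z j'"
    using j' unfolding facet_def G_def by blast
  have "h \<notin> Z k" and "h \<in> P" and G_P: "G \<inter> Z j' \<subseteq> P"
    using h k(2) face_subset[OF G] by auto
  then have h_pos: "0 < R h j'" "0 < R h k"
    using pos Q h(2) by auto
  define c where "c = y j' / R h j'"
  have "y - c *\<^sub>f R h \<in> fun_vs.span (R ` G)"
    using y(1) h(1) unfolding G_def[symmetric] by (rule span_diff_scaled_row)
  then have "y - c *\<^sub>f R h \<in> fun_vs.span (R ` (G \<inter> Z j'))"
    using graded_kernel_in_span[OF \<open>graded R\<close> G] j' h_pos by (simp add: G_def c_def)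
  then have "(y - c *\<^sub>f R h) k = 0"
    using G_P by (rule span_vanish[OF _ _ Q(2)]) (use k(2) in blast)
  then have "0 \<le> c"
    using y(2)[OF k(1)] h_pos(2) by (simp add: zero_le_mult_iff)
  then show ?thesis
    using h_pos(1) by (simp add: c_def zero_le_divide_iff)
qed

lemma subtract_row_to_facet:
  assumes "graded R" and F: "face F" and k: "facet F k"
    and x: "x \<in> fun_vs.span (R ` F)" "\<And>l. facet F l \<Longrightarrow> 0 \<le> x l"
  obtains a t j where "a \<in> F" "0 \<le> t" "facet F j" "x - t *\<^sub>f R a \<in> fun_vs.span (R ` (F \<inter> Z j))"
    "\<And>l. facet F l \<Longrightarrow> 0 \<le> (x - t *\<^sub>f R a) l"
proof -
  obtain a where a: "a \<in> F" "a \<notin> Z k"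
    using k unfolding facet_def by blast
  have a_P: "a \<in> P" using a(1) face_subset[OF F] by blast
  define J where "J = {l. facet F l \<and> a \<notin> Z l}"
  have J: "finite J" "J \<noteq> {}"
    using k a finite_subset[OF _ finite_Q, of J] facet_in_Q by (auto simp: J_def)
  have a_pos: "0 < R a l" if "l \<in> J" for l
    using that pos[OF a_P] facet_in_Q unfolding J_def by blast
  obtain j t where j: "j \<in> J" "x j = t * R a j" and t: "\<forall>l\<in>J. t * R a l \<le> x l"
    using J a_pos by (rule ratio_test[of J "R a" x])
  have facet_j: "facet F j" using j(1) by (simp add: J_def)
  have "0 \<le> t"
    using x(2)[OF facet_j] j(2) a_pos[OF j(1)] by (simp add: zero_le_mult_iff)
  moreover have "0 \<le> (x - t *\<^sub>f R a) l" if "facet F l" for l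
    using that t x(2)[of l] zero_iff[OF a_P facet_in_Q[OF that]] by (auto simp: J_def)
  moreover have "x - t *\<^sub>f R a \<in> fun_vs.span (R ` F)"
    using x(1) a(1) by (rule span_diff_scaled_row)
  then have "x - t *\<^sub>f R a \<in> fun_vs.span (R ` (F \<inter> Z j))"
    using j(2) by (intro graded_kernel_in_span[OF \<open>graded R\<close> F facet_j]) auto
  ultimately show ?thesis
    using that a(1) facet_j by blast
qed

lemma nonneg_on_facets_in_row_cone:
  assumes "graded R" and diamond
  shows "face F \<Longrightarrow> x \<in> fun_vs.span (R ` F) \<Longrightarrow> (\<And>j. facet F j \<Longrightarrow> 0 \<le> x j) \<Longrightarrow> x \<in> row_cone R F"
proof (induction "card F" arbitrary: F x rule: less_induct)
  case less
  note F = \<open>face F\<close>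
  show ?case
  proof (cases "\<exists>k\<in>Q. \<not> F \<subseteq> Z k")
    case False
    then have "x = 0"
      using less.prems(2) span_face_in_all_zeros[OF face_subset[OF F]] by blast
    then show ?thesis by (simp add: zero_in_row_cone)
  next
    case True
    then obtain k where "facet F k" using facet_exists by blast
    then obtain a t j where a: "a \<in> F" "0 \<le> t" and j: "facet F j"
      and y: "x - t *\<^sub>f R a \<in> fun_vs.span (R ` (F \<inter> Z j))"
        "\<And>l. facet F l \<Longrightarrow> 0 \<le> (x - t *\<^sub>f R a) l"
      using subtract_row_to_facet[OF \<open>graded R\<close> F _ less.prems(2,3)] by blast
    have "x - t *\<^sub>f R a \<in> row_cone R (F \<inter> Z j)"
    proof (rule less.hyps)
      show "card (F \<inter> Z j) < card F"
        using facet_psubset[OF j] by (rule psubset_card_mono[OF face_finite[OF F]])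
      show "face (F \<inter> Z j)" using F j by (rule face_Int_facet)
    qed (use y nonneg_on_facets_of_facet[OF assms F j] in blast)+
    then have "x - t *\<^sub>f R a \<in> row_cone R F"
      using row_cone_mono[OF face_finite[OF F]] by blast
    then have "x - t *\<^sub>f R a + t *\<^sub>f R a \<in> row_cone R F"
      using a by (intro row_cone_add_scaled_row face_finite[OF F])
    then show ?thesis by simp
  qed
qed

lemma generating_if_graded_diamond:
  assumes "graded R" and diamond
  shows "row_cone_generating P Q R"
  unfolding row_cone_generating_def
  using nonneg_on_facets_in_row_cone[OF assms face_P] facet_in_Q by blast

end

lemma row_cone_generating_transfer:
  assumes S: "realization P Q Z S" "row_cone_generating P Q S" and R: "realization P Q Z R"
    and dim: "fun_vs.dim (R ` P) \<le> fun_vs.dim (S ` P)"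
  shows "row_cone_generating P Q R"
proof -
  interpret S: realization P Q Z S by fact
  interpret R: realization P Q Z R by fact
  have "S.graded R"
    using S.graded_if_generating[OF S(2)] S(1) dim by (rule R.graded_transfer)
  then show ?thesis
    using S.diamond_if_generating[OF S(2)] by (rule R.generating_if_graded_diamond)
qed

section \<open>Rows of a matrix as functions\<close>

definition vec_fun :: "'a::zero vec \<Rightarrow> nat \<Rightarrow> 'a" where
  "vec_fun v = (\<lambda>j. if j < dim_vec v then v $ j else 0)"

abbreviation row_fun :: "'a::zero mat \<Rightarrow> nat \<Rightarrow> nat \<Rightarrow> 'a" where
  "row_fun M i \<equiv> vec_fun (row M i)"

definition row_rank :: "'a::field mat \<Rightarrow> nat" where
  "row_rank M = fun_vs.dim (row_fun M ` {..<dim_row M})"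

lemma vec_fun_inject: "dim_vec v = dim_vec w \<Longrightarrow> vec_fun v = vec_fun w \<longleftrightarrow> v = w"
  by (auto simp: vec_fun_def fun_eq_iff vec_eq_iff)

lemma inj_on_vec_fun: "inj_on vec_fun (carrier_vec n)"
  by (intro inj_onI) (simp add: vec_fun_inject)

lemma vec_vec_fun: "v \<in> carrier_vec n \<Longrightarrow> vec n (vec_fun v) = v"
  unfolding vec_fun_def by (intro eq_vecI) auto

lemma vec_fun_zero: "vec_fun (0\<^sub>v n) = (0 :: nat \<Rightarrow> 'a::zero)"
  by (simp add: vec_fun_def fun_eq_iff)

lemma transpose_mult_mat_vec:
  fixes A :: "'a::comm_semiring_0 mat"
  assumes "A \<in> carrier_mat p n" and "B \<in> carrier_mat n q" and "u \<in> carrier_vec p"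
  shows "(A * B)\<^sup>T *\<^sub>v u = B\<^sup>T *\<^sub>v (A\<^sup>T *\<^sub>v u)"
  using assms by (simp add: transpose_mult[OF assms(1,2)])

lemma row_mult_transpose:
  fixes A :: "'a::comm_semiring_0 mat"
  assumes "A \<in> carrier_mat p n" and "B \<in> carrier_mat n q" and "i < p"
  shows "row (A * B) i = B\<^sup>T *\<^sub>v row A i"
  using assms by (intro eq_vecI) (auto intro: comm_scalar_prod[of _ n])

lemma mult_mat_vec_inject:
  fixes A :: "'a::field mat"
  assumes A: "A \<in> carrier_mat m n" and kernel: "mat_kernel A = {0\<^sub>v n}"
    and x: "x \<in> carrier_vec n" and y: "y \<in> carrier_vec n" and eq: "A *\<^sub>v x = A *\<^sub>v y"
  shows "x = y"
proof -
  have "A *\<^sub>v (x - y) = 0\<^sub>v m"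
    using A x y eq by (simp add: mult_minus_distrib_mat_vec[OF A x y])
  then have "x - y \<in> mat_kernel A"
    using A x y by (intro mat_kernelI) auto
  then have diff: "x - y = 0\<^sub>v n"
    unfolding kernel by simp
  have "x $ i = y $ i" if "i < n" for i
    using arg_cong[OF diff, of "\<lambda>v. v $ i"] x y that by simp
  then show ?thesis
    using x y by (intro eq_vecI) auto
qed

lemma sum_row_fun:
  fixes M :: "'a::field mat"
  assumes "M \<in> carrier_mat p q"
  shows "(\<Sum>i<p. u i *\<^sub>f row_fun M i) = vec_fun (M\<^sup>T *\<^sub>v vec p u)"
proof
  fix j
  show "(\<Sum>i<p. u i *\<^sub>f row_fun M i) j = vec_fun (M\<^sup>T *\<^sub>v vec p u) j"
    using assms
    by (auto simp: vec_fun_def scalar_prod_def atLeast0LessThan mult.commute intro!: sum.cong)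
qed

lemma row_span_eq:
  fixes M :: "'a::field mat"
  assumes M: "M \<in> carrier_mat p q"
  shows "fun_vs.span (row_fun M ` {..<p}) = (\<lambda>u. vec_fun (M\<^sup>T *\<^sub>v u)) ` carrier_vec p"
proof -
  have "u \<in> (vec p :: _ \<Rightarrow> 'a vec) ` UNIV" if "u \<in> carrier_vec p" for u
    using vec_vec_fun[OF that] by (metis rangeI)
  then have "carrier_vec p = range (vec p :: _ \<Rightarrow> 'a vec)" by auto
  then show ?thesis
    by (simp add: fun_vs.span_image_finite sum_row_fun[OF M] image_image)
qed

lemma row_span_subset_iff_left_factor:
  fixes M T :: "'a::field mat"
  assumes M: "M \<in> carrier_mat p q" and T: "T \<in> carrier_mat d q"
  shows "row_fun M ` {..<p} \<subseteq> fun_vs.span (row_fun T ` {..<d}) \<longleftrightarrow> (\<exists>C \<in> carrier_mat p d. M = C * T)"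
    (is "?L \<longleftrightarrow> ?R")
proof
  assume ?L
  then have "\<exists>u \<in> carrier_vec d. row_fun M i = vec_fun (T\<^sup>T *\<^sub>v u)" if "i < p" for i
    using that unfolding row_span_eq[OF T] by blast
  then have "\<exists>u \<in> carrier_vec d. row M i = T\<^sup>T *\<^sub>v u" if "i < p" for i
    using that M T by (simp add: vec_fun_inject)
  then obtain u where u: "\<And>i. i < p \<Longrightarrow> u i \<in> carrier_vec d" "\<And>i. i < p \<Longrightarrow> row M i = T\<^sup>T *\<^sub>v u i"
    by metis
  define C where "C = mat_of_rows d (map u [0..<p])"
  have C: "C \<in> carrier_mat p d" by (simp add: C_def mat_of_rows_def)
  have "row C i = u i" if "i < p" for i
    using that u(1) by (simp add: C_def)
  then have "M = C * T"
    using M C T u(2) by (intro eq_rowI) (auto simp: row_mult_transpose[OF C T] simp del: row_mult)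
  then show ?R using C by blast
next
  assume ?R
  then show ?L
    using T
    by (auto simp: row_span_eq[OF T] row_mult_transpose[of _ p] simp del: row_mult intro!: imageI)
qed

lemma mat_kernel_transpose_trivial:
  fixes T :: "'a::field mat"
  assumes T: "T \<in> carrier_mat d q"
    and inj: "inj_on (row_fun T) {..<d}" and independent: "fun_vs.independent (row_fun T ` {..<d})"
  shows "mat_kernel T\<^sup>T = {0\<^sub>v d}"
proof -
  have "u = 0\<^sub>v d" if u: "u \<in> carrier_vec d" "T\<^sup>T *\<^sub>v u = 0\<^sub>v q" for u
  proof -
    have "(\<Sum>k<d. vec_fun u k *\<^sub>f row_fun T k) = 0"
      using u by (simp add: sum_row_fun[OF T] vec_vec_fun vec_fun_zero)
    then have "vec_fun u k = 0" if "k < d" for k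
      using fun_vs.independent_imageD[OF inj independent] that by blast
    then show ?thesis
      using u(1) by (intro eq_vecI) (auto simp: vec_fun_def split: if_splits)
  qed
  then show ?thesis
    using T by (auto simp: mat_kernel[of _ q d])
qed

lemma row_basis:
  fixes M :: "'a::field mat"
  assumes M: "M \<in> carrier_mat p q"
  obtains T where "T \<in> carrier_mat (row_rank M) q" "mat_kernel T\<^sup>T = {0\<^sub>v (row_rank M)}"
    "row_fun T ` {..<row_rank M} \<subseteq> fun_vs.span (row_fun M ` {..<p})"
    "row_fun M ` {..<p} \<subseteq> fun_vs.span (row_fun T ` {..<row_rank M})"
proof -
  define d where "d = row_rank M"
  obtain B where B: "B \<subseteq> row_fun M ` {..<p}" "fun_vs.independent B"
      "row_fun M ` {..<p} \<subseteq> fun_vs.span B" "card B = d"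
    using fun_vs.basis_exists[of "row_fun M ` {..<p}"] M unfolding d_def row_rank_def by auto
  obtain U where U: "U \<subseteq> {..<p}" "inj_on (row_fun M) U" "B = row_fun M ` U"
    using B(1) unfolding subset_image_inj by blast
  have "finite U" "card U = d"
    using U B(4) finite_subset by (auto simp: card_image)
  then obtain f where f: "bij_betw f {..<d} U"
    using ex_bij_betw_nat_finite[of U] by (auto simp: atLeast0LessThan)
  define T where "T = mat_of_rows q (map (\<lambda>k. row M (f k)) [0..<d])"
  have T: "T \<in> carrier_mat d q" by (simp add: T_def mat_of_rows_def)
  have rows: "row T k = row M (f k)" if "k < d" for k
    using that M by (simp add: T_def carrier_vecI)
  have B_eq: "row_fun T ` {..<d} = B"
    using rows bij_betw_imp_surj_on[OF f] U(3) by (force simp: image_iff)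
  have "inj_on (row_fun M \<circ> f) {..<d}"
    using f U(2) by (intro comp_inj_on) (auto simp: bij_betw_def)
  then have "inj_on (row_fun T) {..<d}"
    using rows by (simp add: inj_on_def)
  then have "mat_kernel T\<^sup>T = {0\<^sub>v d}"
    using mat_kernel_transpose_trivial[OF T] B(2) B_eq by blast
  moreover have "row_fun T ` {..<d} \<subseteq> fun_vs.span (row_fun M ` {..<p})"
    using B(1) B_eq fun_vs.span_superset by blast
  ultimately show ?thesis
    using that T B(3) B_eq unfolding d_def by blast
qed

lemma row_factorization:
  fixes M :: "'a::field mat"
  assumes M: "M \<in> carrier_mat p q"
  obtains C E T where "C \<in> carrier_mat p (row_rank M)" "E \<in> carrier_mat (row_rank M) p"
    "T \<in> carrier_mat (row_rank M) q" "M = C * T" "T = E * M" "mat_kernel T\<^sup>T = {0\<^sub>v (row_rank M)}"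
proof -
  obtain T where T: "T \<in> carrier_mat (row_rank M) q" "mat_kernel T\<^sup>T = {0\<^sub>v (row_rank M)}"
    and "row_fun T ` {..<row_rank M} \<subseteq> fun_vs.span (row_fun M ` {..<p})"
    and "row_fun M ` {..<p} \<subseteq> fun_vs.span (row_fun T ` {..<row_rank M})"
    using row_basis[OF M] .
  then obtain C E where "C \<in> carrier_mat p (row_rank M)" "M = C * T"
    "E \<in> carrier_mat (row_rank M) p" "T = E * M"
    unfolding row_span_subset_iff_left_factor[OF M T(1)] row_span_subset_iff_left_factor[OF T(1) M]
    by blast
  then show ?thesis using that T by blast
qed

section \<open>Rank\<close>

lemma row_rank_transpose_le:
  fixes M :: "'a::field mat"
  shows "row_rank M\<^sup>T \<le> row_rank M"
proof -
  let ?p = "dim_row M" and ?q = "dim_col M" and ?d = "row_rank M"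
  obtain T where T: "T \<in> carrier_mat ?d ?q"
    and rows: "row_fun M ` {..<?p} \<subseteq> fun_vs.span (row_fun T ` {..<?d})"
    by (rule row_basis[of M ?p ?q]) auto
  then obtain C where C: "C \<in> carrier_mat ?p ?d" and M: "M = C * T"
    using row_span_subset_iff_left_factor[of M ?p ?q T ?d] by blast
  have "M\<^sup>T = T\<^sup>T * C\<^sup>T"
    unfolding M by (rule transpose_mult[OF C T])
  then have "row_fun M\<^sup>T ` {..<?q} \<subseteq> fun_vs.span (row_fun C\<^sup>T ` {..<?d})"
    using C T row_span_subset_iff_left_factor[of "M\<^sup>T" ?q ?p "C\<^sup>T" ?d] by auto
  then have "row_rank M\<^sup>T \<le> card (row_fun C\<^sup>T ` {..<?d})"
    unfolding row_rank_def[of "M\<^sup>T"] by (intro fun_vs.dim_le_card) auto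
  also have "\<dots> \<le> ?d"
    using card_image_le[of "{..<?d}"] by simp
  finally show ?thesis .
qed

lemma row_rank_transpose: "row_rank M\<^sup>T = row_rank (M :: 'a::field mat)"
  using row_rank_transpose_le[of M] row_rank_transpose_le[of "M\<^sup>T"] by simp

lemma row_rank_mult:
  fixes A B :: "'a::field mat"
  assumes A: "A \<in> carrier_mat p n" and B: "B \<in> carrier_mat n q"
    and kernel: "mat_kernel B\<^sup>T = {0\<^sub>v n}"
  shows "row_rank (A * B) = row_rank A"
proof -
  define f where "f = (\<lambda>x. \<Sum>k<n. x k *\<^sub>f row_fun B k)"
  have f_vec_fun: "f (vec_fun v) = vec_fun (B\<^sup>T *\<^sub>v v)" if "v \<in> carrier_vec n" for v
    by (simp add: f_def sum_row_fun[OF B] vec_vec_fun[OF that])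
  have linear: "Vector_Spaces.linear (*\<^sub>f) (*\<^sub>f) f"
    unfolding f_def by (rule linear_row_combination)
  have "x = 0" if x: "x \<in> fun_vs.span (row_fun A ` {..<p})" "f x = 0" for x
  proof -
    obtain u where u: "u \<in> carrier_vec p" "x = vec_fun (A\<^sup>T *\<^sub>v u)"
      using x(1) unfolding row_span_eq[OF A] by blast
    define v where "v = A\<^sup>T *\<^sub>v u"
    have v: "v \<in> carrier_vec n" "x = vec_fun v"
      using A u by (auto simp: v_def)
    then have "vec_fun (B\<^sup>T *\<^sub>v v) = vec_fun (0\<^sub>v q)"
      using x(2) f_vec_fun[OF v(1)] by (simp add: vec_fun_zero)
    then have "v \<in> mat_kernel B\<^sup>T"
      using B v(1) by (intro mat_kernelI[of _ q n]) (auto simp: vec_fun_inject)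
    then show ?thesis
      unfolding v(2) kernel by (simp add: vec_fun_zero)
  qed
  then have "inj_on f (fun_vs.span (row_fun A ` {..<p}))"
    by (subst fun_vs.linear_inj_on_iff_eq_0[OF linear]) auto
  then have "fun_vs.dim (f ` row_fun A ` {..<p}) = fun_vs.dim (row_fun A ` {..<p})"
    by (rule fun_vs.dim_image_eq_inj_on[OF linear])
  moreover have "f ` row_fun A ` {..<p} = row_fun (A * B) ` {..<p}"
    using A unfolding image_image
    by (intro image_cong) (auto simp: f_vec_fun row_mult_transpose[OF A B])
  ultimately show ?thesis
    using A B by (simp add: row_rank_def)
qed

context vec_space
begin

lemma vec_fun_lincomb:
  assumes "finite U" and "U \<subseteq> carrier_vec n"
  shows "vec_fun (lincomb a U) = (\<Sum>v\<in>U. a v *\<^sub>f vec_fun v)"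
proof
  fix j
  have "dim_vec (lincomb a U) = n"
    by (rule lincomb_dim[OF assms])
  moreover have "dim_vec v = n" if "v \<in> U" for v
    using that assms(2) by auto
  ultimately show "vec_fun (lincomb a U) j = (\<Sum>v\<in>U. a v *\<^sub>f vec_fun v) j"
    by (simp add: vec_fun_def lincomb_index[OF _ assms(2)])
qed

lemma independent_vec_fun:
  assumes U: "finite U" "U \<subseteq> carrier_vec n" "lin_indpt U"
  shows "fun_vs.independent (vec_fun ` U)"
proof (rule fun_vs.independent_if_scalars_zero)
  fix a x assume a: "(\<Sum>x\<in>vec_fun ` U. a x *\<^sub>f x) = 0" and "x \<in> vec_fun ` U"
  then obtain v where v: "v \<in> U" "x = vec_fun v" by blast
  have "inj_on vec_fun U"
    using inj_on_vec_fun U(2) by (rule inj_on_subset)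
  then have "vec_fun (lincomb (a \<circ> vec_fun) U) = vec_fun (0\<^sub>v n)"
    using a by (simp add: vec_fun_lincomb[OF U(1,2)] sum.reindex vec_fun_zero)
  then have "lincomb (a \<circ> vec_fun) U = 0\<^sub>v n"
    using lincomb_dim[OF U(1,2)] by (simp add: vec_fun_inject)
  then have "a \<circ> vec_fun \<in> U \<rightarrow> {0}"
    using not_lindepD[OF U(3,1) subset_refl] by simp
  then show "a x = 0"
    using v by auto
qed (use U(1) in simp)

lemma dim_span_vs_eq_dim_vec_fun:
  assumes S: "S \<subseteq> carrier_vec n" "finite S"
  shows "vectorspace.dim class_ring (span_vs S) = fun_vs.dim (vec_fun ` S)"
proof -
  obtain U where U: "finite U" "maximal U (\<lambda>T. T \<subseteq> S \<and> lin_indpt T)"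
    using maximal_exists_superset[of S "\<lambda>T. T \<subseteq> S \<and> lin_indpt T" "{}"] S(2) finite_lin_indpt2
    by auto
  have U_S: "U \<subseteq> S" "lin_indpt U" and U_carrier: "U \<subseteq> carrier_vec n"
    using U(2) S(1) by (auto simp: maximal_def)
  have "v \<in> span U" if v: "v \<in> S" for v
  proof (rule ccontr)
    assume "v \<notin> span U"
    then have "v \<notin> U" and "lin_indpt (U \<union> {v})"
      using lin_dep_iff_in_span[OF U_carrier U_S(2)] span_mem[OF U_carrier] v S(1) by auto
    then show False
      using U(2) U_S(1) v unfolding maximal_def by blast
  qed
  then have "\<exists>a. v = lincomb a U" if "v \<in> S" for v
    using that finite_span[OF U(1) U_carrier] by blast
  then have "vec_fun ` S \<subseteq> fun_vs.span (vec_fun ` U)"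
    by (force simp: fun_vs.span_image_finite[OF U(1)] vec_fun_lincomb[OF U(1) U_carrier])
  then have "card (vec_fun ` U) = fun_vs.dim (vec_fun ` S)"
    using U_S(1) independent_vec_fun[OF U(1) U_carrier U_S(2)]
    by (intro fun_vs.basis_card_eq_dim) auto
  moreover have "inj_on vec_fun U"
    using inj_on_vec_fun U_carrier by (rule inj_on_subset)
  ultimately show ?thesis
    using dim_span[OF S U(2)] by (simp add: card_image)
qed

lemma rank_transpose_eq_row_rank:
  assumes "dim_col A = n"
  shows "rank A\<^sup>T = row_rank A"
proof -
  have "vec_fun ` set (rows A) = row_fun A ` {..<dim_row A}"
    by (auto simp: rows_def image_image atLeast0LessThan)
  moreover have "set (rows A) \<subseteq> carrier_vec n"
    using assms rows_carrier[of A] by simp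
  ultimately show ?thesis
    unfolding rank_def row_rank_def by (simp add: dim_span_vs_eq_dim_vec_fun)
qed

lemma rank_eq_row_rank: "dim_row A = n \<Longrightarrow> rank A = row_rank A"
  using rank_transpose_eq_row_rank[of "A\<^sup>T"] row_rank_transpose[of A] by simp

end

section \<open>Slack matrices\<close>

definition generated_cone :: "'a::linordered_field mat \<Rightarrow> 'a vec set" where
  "generated_cone A = {A\<^sup>T *\<^sub>v y | y. 0\<^sub>v (dim_row A) \<le> y}"

definition halfspace_cone :: "'a::linordered_field mat \<Rightarrow> 'a vec set" where
  "halfspace_cone B = {x \<in> carrier_vec (dim_row B). 0\<^sub>v (dim_col B) \<le> B\<^sup>T *\<^sub>v x}"

definition row_cone_generating_mat :: "'a::linordered_field mat \<Rightarrow> bool" where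
  "row_cone_generating_mat M \<longleftrightarrow> row_cone_generating {..<dim_row M} {..<dim_col M} (row_fun M)"

lemma zero_le_vec_iff:
  "0\<^sub>v n \<le> (y :: 'a::{zero,ord} vec) \<longleftrightarrow> y \<in> carrier_vec n \<and> (\<forall>i<n. 0 \<le> y $ i)"
  by (auto simp: less_eq_vec_def)

lemma slack_matrix_of_iff:
  "slack_matrix_of n K S \<longleftrightarrow> (\<exists>A B. A \<in> carrier_mat (dim_row S) n \<and> B \<in> carrier_mat n (dim_col S) \<and>
     K = halfspace_cone B \<and> K = generated_cone A \<and> S = A * B)"
proof -
  have "halfspace_cone B = {x \<in> carrier_vec n. \<forall>j < dim_col S. x \<bullet> col B j \<ge> 0}"
    if "B \<in> carrier_mat n (dim_col S)" for B :: "real mat"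
    using that by (auto simp: halfspace_cone_def zero_le_vec_iff comm_scalar_prod[of _ n])
  moreover have "generated_cone A =
      {A\<^sup>T *\<^sub>v y | y. y \<in> carrier_vec (dim_row S) \<and> (\<forall>i < dim_row S. y $ i \<ge> 0)}"
    if "A \<in> carrier_mat (dim_row S) n" for A :: "real mat"
    using that by (auto simp: generated_cone_def zero_le_vec_iff)
  ultimately show ?thesis
    unfolding slack_matrix_of_def by (simp cong: conj_cong)
qed

lemma slack_matrix_of_polyhedral_cone: "slack_matrix_of n K S \<Longrightarrow> polyhedral_cone n K"
  unfolding slack_matrix_of_def polyhedral_cone_def by blast

lemma row_in_generated_cone:
  assumes "i < dim_row A"
  shows "row A i \<in> generated_cone A"
proof -
  have "row A i = A\<^sup>T *\<^sub>v unit_vec (dim_row A) i"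
    using assms by (intro eq_vecI) (auto simp: scalar_prod_right_unit)
  moreover have "0\<^sub>v (dim_row A) \<le> (unit_vec (dim_row A) i :: 'a vec)"
    using assms by (auto simp: zero_le_vec_iff)
  ultimately show ?thesis
    unfolding generated_cone_def by blast
qed

lemma generated_cone_subset: "generated_cone A \<subseteq> carrier_vec (dim_col A)"
  unfolding generated_cone_def by (auto simp: carrier_dim_vec)

lemma pointed_halfspace_cone_iff:
  assumes B: "B \<in> carrier_mat n q"
  shows "pointed_cone n (halfspace_cone B) \<longleftrightarrow> mat_kernel B\<^sup>T = {0\<^sub>v n}"
proof -
  have "{x \<in> halfspace_cone B. - x \<in> halfspace_cone B} = mat_kernel B\<^sup>T"
    using B by (force simp: halfspace_cone_def mat_kernel_def zero_le_vec_iff vec_eq_iff)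
  then show ?thesis by (simp add: pointed_cone_def)
qed

lemma cone_dim_generated_cone:
  fixes A :: "'a::linordered_field mat"
  assumes A: "A \<in> carrier_mat p n"
  shows "vec_space.cone_dim n (generated_cone A) = row_rank A"
proof -
  interpret vec_space "TYPE('a)" n .
  have rows: "set (rows A) \<subseteq> carrier_vec n"
    using A rows_carrier[of A] by simp
  have "generated_cone A \<subseteq> span (set (rows A))"
    using A by (auto simp: generated_cone_def zero_le_vec_iff row_space_def[symmetric]
        row_space_eq_col_space_transpose col_space_eq[of "A\<^sup>T" p])
  then have "span (generated_cone A) \<subseteq> span (set (rows A))"
    using rows span_subsetI by blast
  moreover have "set (rows A) \<subseteq> generated_cone A"
    using row_in_generated_cone by (auto simp: rows_def)
  then have "span (set (rows A)) \<subseteq> span (generated_cone A)"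
    by (rule span_is_monotone)
  ultimately have "cone_dim (generated_cone A) = rank A\<^sup>T"
    unfolding cone_dim_def rank_def by simp
  then show ?thesis
    using rank_transpose_eq_row_rank[of A] A by simp
qed

lemma cone_dim_pointed_slack_matrix:
  assumes "slack_matrix_of n K S" and "pointed_cone n K"
  shows "vec_space.cone_dim n K = vec_space.rank (dim_row S) S"
proof -
  obtain A B where A: "A \<in> carrier_mat (dim_row S) n" and B: "B \<in> carrier_mat n (dim_col S)"
    and K: "K = halfspace_cone B" "K = generated_cone A" and S: "S = A * B"
    using assms(1) unfolding slack_matrix_of_iff by blast
  have "mat_kernel B\<^sup>T = {0\<^sub>v n}"
    using assms(2) pointed_halfspace_cone_iff[OF B] K(1) by simp
  then show ?thesis
    using cone_dim_generated_cone[OF A] row_rank_mult[OF A B] K(2) S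
      vec_space.rank_eq_row_rank[OF refl, of S] by simp
qed

lemma slack_matrix_of_nonneg:
  assumes "slack_matrix_of n K S" and i: "i < dim_row S" and j: "j < dim_col S"
  shows "0 \<le> S $$ (i,j)"
proof -
  obtain A B where A: "A \<in> carrier_mat (dim_row S) n" and B: "B \<in> carrier_mat n (dim_col S)"
    and K: "halfspace_cone B = generated_cone A" and S: "S = A * B"
    using assms(1) unfolding slack_matrix_of_iff by blast
  have "row A i \<in> halfspace_cone B"
    using row_in_generated_cone[of i A] A i unfolding K by simp
  moreover have "row S i = B\<^sup>T *\<^sub>v row A i"
    by (subst S, rule row_mult_transpose[OF A B i])
  ultimately have "0\<^sub>v (dim_col S) \<le> row S i"
    using B by (simp add: halfspace_cone_def)
  then show ?thesis
    using i j by (simp add: zero_le_vec_iff)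
qed

lemma row_cone_row_fun:
  assumes M: "M \<in> carrier_mat p q"
  shows "row_cone (row_fun M) {..<p} = vec_fun ` generated_cone M"
proof (intro equalityI subsetI)
  fix x assume "x \<in> row_cone (row_fun M) {..<p}"
  then obtain y where y: "\<forall>i<p. 0 \<le> y i" "x = vec_fun (M\<^sup>T *\<^sub>v vec p y)"
    unfolding row_cone_def sum_row_fun[OF M] by auto
  moreover have "0\<^sub>v (dim_row M) \<le> vec p y"
    using M y(1) by (auto simp: zero_le_vec_iff)
  ultimately show "x \<in> vec_fun ` generated_cone M"
    unfolding generated_cone_def by blast
next
  fix x assume "x \<in> vec_fun ` generated_cone M"
  then obtain y where y: "y \<in> carrier_vec p" "\<forall>i<p. 0 \<le> y $ i" "x = vec_fun (M\<^sup>T *\<^sub>v y)"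
    using M by (auto simp: generated_cone_def zero_le_vec_iff)
  have "x = (\<Sum>i<p. vec_fun y i *\<^sub>f row_fun M i)"
    using y(1,3) by (simp add: sum_row_fun[OF M] vec_vec_fun)
  moreover have "\<forall>i<p. 0 \<le> vec_fun y i"
    using y(1,2) by (simp add: vec_fun_def)
  ultimately show "x \<in> row_cone (row_fun M) {..<p}"
    unfolding row_cone_def by blast
qed

lemma row_cone_generating_mat_iff:
  assumes M: "M \<in> carrier_mat p q"
  shows "row_cone_generating_mat M \<longleftrightarrow>
    (\<forall>u \<in> carrier_vec p. 0\<^sub>v q \<le> M\<^sup>T *\<^sub>v u \<longrightarrow> M\<^sup>T *\<^sub>v u \<in> generated_cone M)"
proof -
  have "(\<forall>j\<in>{..<q}. 0 \<le> vec_fun (M\<^sup>T *\<^sub>v u) j) \<longleftrightarrow> 0\<^sub>v q \<le> M\<^sup>T *\<^sub>v u" for u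
    using M by (auto simp: vec_fun_def zero_le_vec_iff carrier_vecI)
  moreover have "vec_fun (M\<^sup>T *\<^sub>v u) \<in> vec_fun ` generated_cone M \<longleftrightarrow>
      M\<^sup>T *\<^sub>v u \<in> generated_cone M" for u
    using M generated_cone_subset[of M]
    by (intro inj_on_image_mem_iff[OF inj_on_vec_fun[of q]]) (auto simp: carrier_dim_vec)
  ultimately show ?thesis
    using M
    by (simp add: row_cone_generating_mat_def row_cone_generating_def
        row_span_eq[OF M] row_cone_row_fun[OF M])
qed

lemma slack_matrix_of_row_cone_generating:
  assumes "slack_matrix_of n K S"
  shows "row_cone_generating_mat S"
proof -
  obtain A B where A: "A \<in> carrier_mat (dim_row S) n" and B: "B \<in> carrier_mat n (dim_col S)"
    and K: "halfspace_cone B = generated_cone A" and S: "S = A * B"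
    using assms unfolding slack_matrix_of_iff by blast
  have transpose: "S\<^sup>T *\<^sub>v u = B\<^sup>T *\<^sub>v (A\<^sup>T *\<^sub>v u)" if "u \<in> carrier_vec (dim_row S)" for u
    using transpose_mult_mat_vec[OF A B that] S by simp
  have "S\<^sup>T *\<^sub>v u \<in> generated_cone S"
    if u: "u \<in> carrier_vec (dim_row S)" and nonneg: "0\<^sub>v (dim_col S) \<le> S\<^sup>T *\<^sub>v u" for u
  proof -
    have "A\<^sup>T *\<^sub>v u \<in> halfspace_cone B"
      using A B u nonneg by (simp add: halfspace_cone_def transpose)
    then obtain y where y: "A\<^sup>T *\<^sub>v u = A\<^sup>T *\<^sub>v y" "0\<^sub>v (dim_row S) \<le> y"
      using A unfolding K generated_cone_def by auto
    then have "S\<^sup>T *\<^sub>v u = S\<^sup>T *\<^sub>v y"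
      using u by (simp add: transpose zero_le_vec_iff)
    then show ?thesis
      using y(2) unfolding generated_cone_def by blast
  qed
  then show ?thesis
    by (simp add: row_cone_generating_mat_iff[of S "dim_row S" "dim_col S"])
qed

lemma transpose_mult_mat_vec_nonneg:
  fixes M :: "'a::linordered_field mat"
  assumes M: "M \<in> carrier_mat p q" and nonneg: "\<forall>i<p. \<forall>j<q. 0 \<le> M $$ (i,j)" and y: "0\<^sub>v p \<le> y"
  shows "0\<^sub>v q \<le> M\<^sup>T *\<^sub>v y"
proof -
  have "0 \<le> (M\<^sup>T *\<^sub>v y) $ j" if "j < q" for j
    using M nonneg y that
    by (auto simp: zero_le_vec_iff scalar_prod_def intro!: sum_nonneg mult_nonneg_nonneg)
  then show ?thesis
    using M by (simp add: zero_le_vec_iff carrier_vecI)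
qed

text \<open>The map \<open>x \<mapsto> x\<^sup>T T\<close> identifies the cone \<open>{x. x\<^sup>T T \<ge> 0}\<close> with the nonnegative vectors of
  the row space of \<open>M\<close>.\<close>

lemma halfspace_cone_eq_generated_cone:
  fixes M :: "'a::linordered_field mat"
  assumes C: "C \<in> carrier_mat p d" and T: "T \<in> carrier_mat d q" and E: "E \<in> carrier_mat d p"
    and M: "M \<in> carrier_mat p q" "M = C * T" "T = E * M" and kernel: "mat_kernel T\<^sup>T = {0\<^sub>v d}"
    and nonneg: "\<forall>i<p. \<forall>j<q. 0 \<le> M $$ (i,j)" and generating: "row_cone_generating_mat M"
  shows "halfspace_cone T = generated_cone C"
proof (intro equalityI subsetI)
  have M_C: "M\<^sup>T *\<^sub>v y = T\<^sup>T *\<^sub>v (C\<^sup>T *\<^sub>v y)" and Cy: "C\<^sup>T *\<^sub>v y \<in> carrier_vec d"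
    if "y \<in> carrier_vec p" for y
    using transpose_mult_mat_vec[OF C T that] C M(2) that by auto
  {
    fix x assume "x \<in> generated_cone C"
    then obtain y where y: "0\<^sub>v p \<le> y" "x = C\<^sup>T *\<^sub>v y"
      using C by (auto simp: generated_cone_def)
    then have "0\<^sub>v q \<le> T\<^sup>T *\<^sub>v x" "x \<in> carrier_vec d"
      using transpose_mult_mat_vec_nonneg[OF M(1) nonneg y(1)] M_C[of y] Cy[of y]
      by (auto simp: zero_le_vec_iff)
    then show "x \<in> halfspace_cone T"
      using T by (simp add: halfspace_cone_def)
  }
  fix x assume "x \<in> halfspace_cone T"
  then have x: "x \<in> carrier_vec d" "0\<^sub>v q \<le> T\<^sup>T *\<^sub>v x"
    using T by (auto simp: halfspace_cone_def)
  have "T\<^sup>T *\<^sub>v x = M\<^sup>T *\<^sub>v (E\<^sup>T *\<^sub>v x)"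
    by (subst M(3), rule transpose_mult_mat_vec[OF E M(1) x(1)])
  moreover have "E\<^sup>T *\<^sub>v x \<in> carrier_vec p"
    using E x(1) by simp
  ultimately have "T\<^sup>T *\<^sub>v x \<in> generated_cone M"
    using generating x(2) unfolding row_cone_generating_mat_iff[OF M(1)] by metis
  then obtain y where y: "0\<^sub>v p \<le> y" "T\<^sup>T *\<^sub>v x = M\<^sup>T *\<^sub>v y"
    using M(1) by (auto simp: generated_cone_def)
  then have y_carrier: "y \<in> carrier_vec p" by (simp add: zero_le_vec_iff)
  have "T\<^sup>T *\<^sub>v x = T\<^sup>T *\<^sub>v (C\<^sup>T *\<^sub>v y)"
    using y(2) M_C[OF y_carrier] by simp
  then have "x = C\<^sup>T *\<^sub>v y"
    using T by (intro mult_mat_vec_inject[of _ q d, OF _ kernel x(1) Cy[OF y_carrier]]) auto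
  then show "x \<in> generated_cone C"
    using C y(1) by (auto simp: generated_cone_def)
qed

lemma row_cone_generating_pointed_slack_matrix:
  assumes nonneg: "\<forall>i < dim_row M. \<forall>j < dim_col M. M $$ (i,j) \<ge> 0"
    and generating: "row_cone_generating_mat M"
  obtains n K where "slack_matrix_of n K M" "pointed_cone n K"
proof -
  let ?p = "dim_row M" and ?q = "dim_col M" and ?d = "row_rank M"
  have M: "M \<in> carrier_mat ?p ?q" by simp
  obtain C E T where C: "C \<in> carrier_mat ?p ?d" and E: "E \<in> carrier_mat ?d ?p"
    and T: "T \<in> carrier_mat ?d ?q" and factors: "M = C * T" "T = E * M"
    and kernel: "mat_kernel T\<^sup>T = {0\<^sub>v ?d}"
    using row_factorization[OF M] .
  have "halfspace_cone T = generated_cone C"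
    by (rule halfspace_cone_eq_generated_cone[OF C T E M factors kernel nonneg generating])
  then have "slack_matrix_of ?d (halfspace_cone T) M"
    unfolding slack_matrix_of_iff using C T factors(1) by blast
  moreover have "pointed_cone ?d (halfspace_cone T)"
    using pointed_halfspace_cone_iff[OF T] kernel by simp
  ultimately show ?thesis by (rule that)
qed

lemma realization_row_fun:
  assumes "\<forall>i < dim_row M. \<forall>j < dim_col M. M $$ (i,j) \<ge> 0"
  shows "realization {..<dim_row M} {..<dim_col M} (\<lambda>j. {i. inc_mat M $$ (i,j) = 1}) (row_fun M)"
  using assms by unfold_locales (auto simp: vec_fun_def inc_mat_def split: if_splits)

lemma row_cone_generating_mat_transfer:
  assumes inc: "inc_mat M = inc_mat S"
    and M: "\<forall>i < dim_row M. \<forall>j < dim_col M. M $$ (i,j) \<ge> 0"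
    and S: "\<forall>i < dim_row S. \<forall>j < dim_col S. S $$ (i,j) \<ge> 0" "row_cone_generating_mat S"
    and rank: "vec_space.rank (dim_row M) M \<le> vec_space.rank (dim_row S) S"
  shows "row_cone_generating_mat M"
proof -
  have dims: "dim_row S = dim_row M" "dim_col S = dim_col M"
    using arg_cong[OF inc, of dim_row] arg_cong[OF inc, of dim_col] by (auto simp: inc_mat_def)
  have "row_rank M \<le> row_rank S"
    using rank by (simp add: vec_space.rank_eq_row_rank)
  then have "fun_vs.dim (row_fun M ` {..<dim_row M}) \<le> fun_vs.dim (row_fun S ` {..<dim_row M})"
    by (simp add: row_rank_def dims)
  moreover have "realization {..<dim_row M} {..<dim_col M}
      (\<lambda>j. {i. inc_mat M $$ (i,j) = 1}) (row_fun S)"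
    using realization_row_fun[OF S(1)] unfolding inc dims .
  moreover have "row_cone_generating {..<dim_row M} {..<dim_col M} (row_fun S)"
    using S(2) unfolding row_cone_generating_mat_def dims .
  ultimately show ?thesis
    using realization_row_fun[OF M] row_cone_generating_transfer
    unfolding row_cone_generating_mat_def by blast
qed

theorem theorem4p3:
  fixes M :: "real mat"
  assumes "\<forall>i < dim_row M. \<forall>j < dim_col M. M $$ (i,j) \<ge> 0"
    and "vec_space.rank (dim_row M) M \<ge> 2"
  shows "is_slack_matrix M \<longleftrightarrow>
    (\<exists>n K. polyhedral_cone n K \<and> pointed_cone n K \<and>
       vec_space.cone_dim n K = vec_space.rank (dim_row M) M \<and>
       incidence_matrix_of n K (inc_mat M))" (is "_ \<longleftrightarrow> (\<exists>n K. ?incidence n K)")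
proof
  assume "is_slack_matrix M"
  then have "row_cone_generating_mat M"
    unfolding is_slack_matrix_def using slack_matrix_of_row_cone_generating by blast
  then obtain n K where "slack_matrix_of n K M" "pointed_cone n K"
    using row_cone_generating_pointed_slack_matrix[OF assms(1)] by blast
  then have "?incidence n K"
    using slack_matrix_of_polyhedral_cone cone_dim_pointed_slack_matrix
    unfolding incidence_matrix_of_def by blast
  then show "\<exists>n K. ?incidence n K" by blast
next
  assume "\<exists>n K. ?incidence n K"
  then obtain n K S where S: "slack_matrix_of n K S" "inc_mat M = inc_mat S"
    and pointed: "pointed_cone n K"
    and dim: "vec_space.cone_dim n K = vec_space.rank (dim_row M) M"
    unfolding incidence_matrix_of_def by blast
  have "row_cone_generating_mat M"
    using slack_matrix_of_nonneg[OF S(1)] slack_matrix_of_row_cone_generating[OF S(1)]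
      cone_dim_pointed_slack_matrix[OF S(1) pointed] dim
    by (intro row_cone_generating_mat_transfer[OF S(2) assms(1)]) auto
  then show "is_slack_matrix M"
    using row_cone_generating_pointed_slack_matrix[OF assms(1)]
    unfolding is_slack_matrix_def by blast
qed

end
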